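(* For arbitrary Banach spaces $X$ and $Y$, the set $w^*\mathrm{QNA}(X,Y^* )$ is dense in $\mathcal{L}(X,Y^* )$. Indeed, given $T\in\mathcal{L}(X,Y^* )$ and $\varepsilon>0$, there is a rank-one perturbation $S\in w^*\mathrm{QNA}(X,Y^* )$ of $T$ such that $\|T-S\|<\varepsilon$.
   Context: Banach spaces are over $\mathbb{K}=\mathbb{R}$ or $\mathbb{C}$. $B_X$ is the closed unit ball of $X$, $X^*$ its topological dual, and $\mathcal{L}(X,Y)$ the space of bounded linear operators from $X$ to $Y$ with the operator norm; density is with respect to this norm. An operator $T\in\mathcal{L}(X,Y^* )$ weak-star quasi attains its norm, written $T\in w^*\mathrm{QNA}(X,Y^* )$, if there exist a net $(x_\alpha)\subset B_X$ and $u^*\in Y^*$ with $\|u^*\|=\|T\|$ such that $Tx_\alpha\to u^*$ in the weak-star topology $\sigma(Y^*,Y)$; equivalently, the $\sigma(Y^*,Y)$-closure of $T(B_X)$ intersects the sphere $\{u^*\in Y^*:\|u^*\|=\|T\|\}$. *)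

theory Defs
  imports "HOL-Analysis.Analysis"
begin

text \<open>The scalar fields: normed fields that are isometrically isomorphic, as real algebras,
  to \<^typ>\<open>real\<close> (embedded in \<^typ>\<open>complex\<close> as \<open>\<real>\<close>) or to \<^typ>\<open>complex\<close>.\<close>

class real_or_complex = real_normed_field +
  assumes real_or_complex:
    "\<exists>\<phi> :: 'a \<Rightarrow> complex.
       (\<forall>x y. \<phi> (x + y) = \<phi> x + \<phi> y) \<and> (\<forall>x y. \<phi> (x * y) = \<phi> x * \<phi> y) \<and>
       (\<forall>r x. \<phi> (r *\<^sub>R x) = r *\<^sub>R \<phi> x) \<and> (\<forall>x. norm (\<phi> x) = norm x) \<and>
       (range \<phi> = \<real> \<or> range \<phi> = UNIV)"

instance real :: real_or_complex
  by standard (rule exI[of _ complex_of_real], auto simp: Reals_def scaleR_conv_of_real)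

instance complex :: real_or_complex
  by standard (rule exI[of _ "\<lambda>x. x"], auto)

text \<open>A normed space over \<open>'k\<close> is a real normed vector space with a \<open>'k\<close>-scalar multiplication
  that extends the real one and for which the norm is absolutely homogeneous.\<close>

locale normed_space_over = vector_space scale
  for scale :: "'k::real_or_complex \<Rightarrow> 'a::real_normed_vector \<Rightarrow> 'a" +
  assumes scale_of_real: "scale (of_real r) x = r *\<^sub>R x"
    and norm_scale: "norm (scale c x) = norm c * norm x"

text \<open>\<^typ>\<open>'a \<Rightarrow>\<^sub>L 'b\<close> consists of the bounded real-linear maps, so over \<open>'k\<close> the spaces of
  bounded linear operators and functionals are subsets of such types. The norm is the
  operator norm in each case.\<close>

definition bounded_ops ::
  "('k::real_or_complex \<Rightarrow> 'a::real_normed_vector \<Rightarrow> 'a) \<Rightarrow> ('k \<Rightarrow> 'b::real_normed_vector \<Rightarrow> 'b)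
    \<Rightarrow> ('a \<Rightarrow>\<^sub>L 'b) set"
  where "bounded_ops sX sY = {T. Vector_Spaces.linear sX sY (blinfun_apply T)}"

definition dual :: "('k::real_or_complex \<Rightarrow> 'a::real_normed_vector \<Rightarrow> 'a) \<Rightarrow> ('a \<Rightarrow>\<^sub>L 'k) set"
  where "dual sX = bounded_ops sX (*)"

definition dual_scale :: "'k::real_or_complex \<Rightarrow> ('a::real_normed_vector \<Rightarrow>\<^sub>L 'k) \<Rightarrow> ('a \<Rightarrow>\<^sub>L 'k)"
  where "dual_scale c f = blinfun_mult_right c o\<^sub>L f"

definition ops_to_dual ::
  "('k::real_or_complex \<Rightarrow> 'a::real_normed_vector \<Rightarrow> 'a) \<Rightarrow> ('k \<Rightarrow> 'b::real_normed_vector \<Rightarrow> 'b)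
    \<Rightarrow> ('a \<Rightarrow>\<^sub>L ('b \<Rightarrow>\<^sub>L 'k)) set"
  where "ops_to_dual sX sY = {T \<in> bounded_ops sX dual_scale. range (blinfun_apply T) \<subseteq> dual sY}"

text \<open>The topology of pointwise convergence on the dual: it is induced from the product topology
  (\<^term>\<open>euclidean\<close> at the function type).\<close>

definition weak_star ::
  "('k::real_or_complex \<Rightarrow> 'a::real_normed_vector \<Rightarrow> 'a) \<Rightarrow> ('a \<Rightarrow>\<^sub>L 'k) topology"
  where "weak_star sX = pullback_topology (dual sX) blinfun_apply (euclidean :: ('a \<Rightarrow> 'k) topology)"

text \<open>A net in the unit ball is represented by the proper filter on \<open>X\<close> generated by its tails.\<close>

definition wstar_QNA ::
  "('k::real_or_complex \<Rightarrow> 'a::real_normed_vector \<Rightarrow> 'a) \<Rightarrow> ('k \<Rightarrow> 'b::real_normed_vector \<Rightarrow> 'b)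
    \<Rightarrow> ('a \<Rightarrow>\<^sub>L ('b \<Rightarrow>\<^sub>L 'k)) set"
  where "wstar_QNA sX sY =
    {T \<in> ops_to_dual sX sY.
       \<exists>F u. F \<noteq> bot \<and> (\<forall>\<^sub>F x in F. x \<in> cball 0 1) \<and> u \<in> dual sY \<and> norm u = norm T \<and>
         limitin (weak_star sY) (blinfun_apply T) u F}"

definition rank_one :: "('a::real_normed_vector \<Rightarrow>\<^sub>L ('b::real_normed_vector \<Rightarrow>\<^sub>L 'k::real_or_complex)) \<Rightarrow> bool"
  where "rank_one R \<longleftrightarrow>
    vector_space.dim (dual_scale :: 'k \<Rightarrow> ('b \<Rightarrow>\<^sub>L 'k) \<Rightarrow> _) (range (blinfun_apply R)) = 1"

lemma dual_scale_apply [simp]: "blinfun_apply (dual_scale c f) y = c * blinfun_apply f y"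
  by (simp add: dual_scale_def)

lemma normed_space_over_dual_scale:
  "normed_space_over (dual_scale :: 'k::real_or_complex \<Rightarrow> ('a::real_normed_vector \<Rightarrow>\<^sub>L 'k) \<Rightarrow> _)"
proof
  fix c d :: 'k and f g :: "'a \<Rightarrow>\<^sub>L 'k" and r :: real
  show "dual_scale c (f + g) = dual_scale c f + dual_scale c g"
    by (rule blinfun_eqI) (simp add: blinfun.bilinear_simps algebra_simps)
  show "dual_scale (c + d) f = dual_scale c f + dual_scale d f"
    by (rule blinfun_eqI) (simp add: blinfun.bilinear_simps algebra_simps)
  show "dual_scale c (dual_scale d f) = dual_scale (c * d) f"
    by (rule blinfun_eqI) (simp add: algebra_simps)
  show "dual_scale 1 f = f"
    by (rule blinfun_eqI) simp
  show "dual_scale (of_real r) f = r *\<^sub>R f"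
    by (rule blinfun_eqI) (simp add: blinfun.bilinear_simps scaleR_conv_of_real)
  have le: "norm (dual_scale c f) \<le> norm c * norm f" for c :: 'k and f :: "'a \<Rightarrow>\<^sub>L 'k"
  proof (rule norm_blinfun_bound)
    fix x
    show "norm (blinfun_apply (dual_scale c f) x) \<le> norm c * norm f * norm x"
      using mult_left_mono[OF norm_blinfun[of f x] norm_ge_zero[of c]]
      by (simp add: norm_mult mult.assoc)
  qed simp
  show "norm (dual_scale c f) = norm c * norm f"
  proof (cases "c = 0")
    case True
    then show ?thesis using le[of c f] by simp
  next
    case False
    have "dual_scale (inverse c) (dual_scale c f) = f"
      using False by (intro blinfun_eqI) simp
    then have "norm f \<le> norm (inverse c) * norm (dual_scale c f)"
      using le[of "inverse c" "dual_scale c f"] by simp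
    then have "norm c * norm f \<le> norm (dual_scale c f)"
      using False by (simp only: norm_inverse) (simp add: divide_simps mult.commute)
    then show ?thesis using le[of c f] by simp
  qed
qed

lemma dual_real: "dual (scaleR :: real \<Rightarrow> 'a::real_normed_vector \<Rightarrow> 'a) = UNIV"
proof -
  have "Vector_Spaces.linear scaleR (*) (blinfun_apply f)" for f :: "'a \<Rightarrow>\<^sub>L real"
    using bounded_linear.linear[OF blinfun.bounded_linear_right[of f]]
    by (simp add: linear_def real_scaleR_def[abs_def])
  then show ?thesis by (auto simp: dual_def bounded_ops_def)
qed

lemma topspace_weak_star [simp]: "topspace (weak_star sX) = dual sX"
  by (simp add: weak_star_def topspace_pullback_topology)

lemma limitin_weak_star_iff:
  fixes sX :: "'k::real_or_complex \<Rightarrow> 'a::real_normed_vector \<Rightarrow> 'a"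
  assumes "\<forall>\<^sub>F x in F. f x \<in> dual sX"
  shows "limitin (weak_star sX) f u F \<longleftrightarrow>
    u \<in> dual sX \<and> (\<forall>y. ((\<lambda>x. blinfun_apply (f x) y) \<longlongrightarrow> blinfun_apply u y) F)"
proof -
  have "limitin (weak_star sX) f u F \<longleftrightarrow>
    u \<in> dual sX \<and> ((\<lambda>x. blinfun_apply (f x)) \<longlongrightarrow> blinfun_apply u) F"
    (is "?L \<longleftrightarrow> ?R")
  proof
    assume L: ?L
    show ?R
    proof
      show "u \<in> dual sX" using L by (simp add: limitin_def)
      show "((\<lambda>x. blinfun_apply (f x)) \<longlongrightarrow> blinfun_apply u) F"
      proof (rule topological_tendstoI)
        fix S :: "('a \<Rightarrow> 'k) set" assume S: "open S" "blinfun_apply u \<in> S"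
        have "openin (weak_star sX) (blinfun_apply -` S \<inter> dual sX)"
          unfolding weak_star_def openin_pullback_topology using S by auto
        then have "\<forall>\<^sub>F x in F. f x \<in> blinfun_apply -` S \<inter> dual sX"
          using L S unfolding limitin_def by auto
        then show "\<forall>\<^sub>F x in F. blinfun_apply (f x) \<in> S"
          by (rule eventually_mono) auto
      qed
    qed
  next
    assume R: ?R
    show ?L
      unfolding limitin_def
    proof (intro conjI allI impI)
      show "u \<in> topspace (weak_star sX)" using R by simp
      fix U assume U: "openin (weak_star sX) U \<and> u \<in> U"
      then obtain S where S: "open S" "U = blinfun_apply -` S \<inter> dual sX"
        unfolding weak_star_def openin_pullback_topology by auto
      then have "\<forall>\<^sub>F x in F. blinfun_apply (f x) \<in> S"
        using R U by (auto intro: topological_tendstoD)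
      with assms show "\<forall>\<^sub>F x in F. f x \<in> U"
        by eventually_elim (simp add: S)
    qed
  qed
  moreover have "((\<lambda>x. blinfun_apply (f x)) \<longlongrightarrow> blinfun_apply u) F \<longleftrightarrow>
      (\<forall>y. ((\<lambda>x. blinfun_apply (f x) y) \<longlongrightarrow> blinfun_apply u y) F)"
    using limitin_componentwise[of "\<lambda>_::'a. euclidean :: 'k topology" UNIV
        "\<lambda>x. blinfun_apply (f x)" "blinfun_apply u" F]
    by (simp add: euclidean_product_topology)
  ultimately show ?thesis by blast
qed

lemma wstar_QNA_iff_closure:
  "T \<in> wstar_QNA sX sY \<longleftrightarrow> T \<in> ops_to_dual sX sY \<and>
    (weak_star sY closure_of (blinfun_apply T ` cball 0 1)) \<inter> {u \<in> dual sY. norm u = norm T} \<noteq> {}"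
proof -
  have "(\<exists>F. F \<noteq> bot \<and> (\<forall>\<^sub>F x in F. x \<in> cball 0 1) \<and> limitin (weak_star sY) (blinfun_apply T) u F)
      \<longleftrightarrow> u \<in> weak_star sY closure_of (blinfun_apply T ` cball 0 1)" for u
  proof
    assume "\<exists>F. F \<noteq> bot \<and> (\<forall>\<^sub>F x in F. x \<in> cball 0 1) \<and> limitin (weak_star sY) (blinfun_apply T) u F"
    then obtain F where F: "F \<noteq> bot" "\<forall>\<^sub>F x in F. x \<in> cball 0 1"
      "limitin (weak_star sY) (blinfun_apply T) u F" by blast
    show "u \<in> weak_star sY closure_of (blinfun_apply T ` cball 0 1)"
      unfolding in_closure_of
    proof (intro conjI allI impI)
      show "u \<in> topspace (weak_star sY)" using F(3) by (simp add: limitin_def)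
      fix U assume "u \<in> U \<and> openin (weak_star sY) U"
      then have "\<forall>\<^sub>F x in F. blinfun_apply T x \<in> U" using F(3) by (simp add: limitin_def)
      with F(2) have "\<forall>\<^sub>F x in F. x \<in> cball 0 1 \<and> blinfun_apply T x \<in> U"
        by eventually_elim simp
      then obtain x where "x \<in> cball 0 1 \<and> blinfun_apply T x \<in> U"
        using F(1) eventually_happens' by blast
      then show "\<exists>y. y \<in> blinfun_apply T ` cball 0 1 \<and> y \<in> U" by blast
    qed
  next
    assume u: "u \<in> weak_star sY closure_of (blinfun_apply T ` cball 0 1)"
    define N where "N = {U. openin (weak_star sY) U \<and> u \<in> U}"
    define P where "P U = cball 0 1 \<inter> blinfun_apply T -` U" for U
    define F where "F = (INF U\<in>N. principal (P U))"
    have top: "u \<in> dual sY" using u by (simp add: in_closure_of)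
    then have "topspace (weak_star sY) \<in> N" by (simp add: N_def del: topspace_weak_star) simp
    then have ne: "N \<noteq> {}" by blast
    have ev: "eventually Q F \<longleftrightarrow> (\<exists>U\<in>N. eventually Q (principal (P U)))" for Q
      unfolding F_def
    proof (rule eventually_INF_base[OF ne])
      fix U V assume "U \<in> N" "V \<in> N"
      then have "U \<inter> V \<in> N" by (auto simp: N_def)
      then show "\<exists>W\<in>N. principal (P W) \<le> inf (principal (P U)) (principal (P V))"
        by (intro bexI[of _ "U \<inter> V"]) (auto simp: P_def)
    qed
    have "P U \<noteq> {}" if "U \<in> N" for U
      using u that unfolding in_closure_of N_def P_def by blast
    then have "F \<noteq> bot"
      unfolding trivial_limit_def ev eventually_principal by auto
    moreover have "\<forall>\<^sub>F x in F. x \<in> cball 0 1"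
      unfolding ev eventually_principal using ne by (auto simp: P_def)
    moreover have "limitin (weak_star sY) (blinfun_apply T) u F"
      unfolding limitin_def ev eventually_principal
      using top by (auto simp: N_def P_def)
    ultimately show "\<exists>F. F \<noteq> bot \<and> (\<forall>\<^sub>F x in F. x \<in> cball 0 1) \<and>
        limitin (weak_star sY) (blinfun_apply T) u F" by blast
  qed
  then show ?thesis unfolding wstar_QNA_def by blast
qed

end

theory Submission
  imports Defs "HOL-Real_Asymp.Real_Asymp"
begin

text \<open>Perturb \<open>T\<close> by \<open>z \<otimes> g\<close>, where \<open>z\<close> is a small functional of the form \<open>z = z\<^sub>0 + T(\<cdot>)(w)\<close> with
  \<open>z\<^sub>0\<close> fixed and \<open>w\<close> in \<open>Y\<close>. A Lindenstrauss-type iteration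
  \<open>w\<^sub>k\<^sub>+\<^sub>1 = w\<^sub>k + \<lambda>\<^sub>k y\<^sub>k\<close>, in which \<open>x\<^sub>k\<close> almost maximizes \<open>\<parallel>T x\<parallel> + \<bar>z\<^sub>k(x)\<bar>\<close> over the unit ball and
  \<open>y\<^sub>k\<close> almost norms \<open>T x\<^sub>k\<close>, forces \<open>\<bar>T x\<^sub>m y\<^sub>k\<bar>\<close> to be almost as large as \<open>\<parallel>T x\<^sub>k\<parallel>\<close> for all \<open>m > k\<close>.
  Hence a weak-star cluster point \<open>u\<close> of \<open>T x\<^sub>m\<close> loses no norm, and with \<open>\<zeta> = lim z(x\<^sub>m)\<close> along the same
  filter, \<open>\<parallel>u\<parallel> + \<bar>\<zeta>\<bar>\<close> is the maximum of \<open>\<parallel>T x\<parallel> + \<bar>z(x)\<bar>\<close>. Choosing \<open>g\<close> as a unit vector such that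
  \<open>\<zeta> g\<close> points in the direction of \<open>u\<close>, the operator \<open>T + z \<otimes> g\<close> has norm \<open>\<parallel>u + \<zeta> g\<parallel>\<close>, and
  \<open>u + \<zeta> g\<close> is a weak-star limit of its values on the unit ball.\<close>

subsection \<open>The Hahn-Banach theorem\<close>

definition sublinear :: "('a::real_vector \<Rightarrow> real) \<Rightarrow> bool"
  where "sublinear q \<longleftrightarrow> (\<forall>x y. q (x + y) \<le> q x + q y) \<and> (\<forall>x. \<forall>t\<ge>0. q (t *\<^sub>R x) = t * q x)"

text \<open>Applying the scaling bound with \<open>inverse t\<close> gives the reverse bound, and
  the factors 2 and 1/2 squeeze \<open>q 0\<close> to 0. Hence infima of sublinear functionals need
  only be checked for upper estimates with \<open>t > 0\<close>.\<close>

lemma sublinearI: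
  assumes add: "\<And>x y. q (x + y) \<le> q x + q y"
    and scale: "\<And>x t. t > 0 \<Longrightarrow> q (t *\<^sub>R x) \<le> t * q x"
  shows "sublinear q"
proof -
  have "q 0 \<le> (1 / 2) * q 0" using scale[of "1 / 2" 0] by simp
  moreover have "q 0 \<le> 2 * q 0" using scale[of 2 0] by simp
  ultimately have q0: "q 0 = 0" by simp
  have "q (t *\<^sub>R x) = t * q x" if "t > 0" for t x
  proof (rule antisym)
    show "q (t *\<^sub>R x) \<le> t * q x" using scale that .
    have "q x \<le> inverse t * q (t *\<^sub>R x)" using scale[of "inverse t" "t *\<^sub>R x"] that by simp
    then show "t * q x \<le> q (t *\<^sub>R x)" using that by (simp add: field_simps)
  qed
  then show ?thesis
    unfolding sublinear_def using add q0 by (auto simp: le_less)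
qed

lemma sublinear_add: "sublinear q \<Longrightarrow> q (x + y) \<le> q x + q y"
  and sublinear_scale: "sublinear q \<Longrightarrow> t \<ge> 0 \<Longrightarrow> q (t *\<^sub>R x) = t * q x"
  by (auto simp: sublinear_def)

lemma sublinear_zero: "sublinear q \<Longrightarrow> q 0 = 0"
  using sublinear_scale[of q 0 0] by simp

lemma sublinear_minus_le: "sublinear q \<Longrightarrow> - q (- x) \<le> q x"
  using sublinear_add[of q x "- x"] sublinear_zero[of q] by simp

text \<open>The witness is the infimum over \<open>t \<ge> 0\<close> of
  \<open>q (x + t *\<^sub>R y) - t * q y\<close>, bounded below by \<open>- q (- x)\<close>; at
  \<open>- y\<close> the choice \<open>t = 1\<close> gives the last claim. It follows that a minimal
  sublinear functional cannot exceed \<open>- q y\<close> at \<open>- y\<close>, so it is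
  odd.\<close>

lemma sublinear_decrease:
  fixes q :: "'a::real_vector \<Rightarrow> real"
  assumes q: "sublinear q"
  obtains q' where "sublinear q'" "q' \<le> q" "q' (- y) \<le> - q y"
proof -
  define h where "h x t = q (x + t *\<^sub>R y) - t * q y" for x t
  define q' where "q' x = (INF t\<in>{0..}. h x t)" for x
  have lower: "- q (- x) \<le> h x t" if "t \<ge> 0" for x t
    using sublinear_add[OF q, of "x + t *\<^sub>R y" "- x"] sublinear_scale[OF q that, of y]
    by (simp add: h_def)
  have bdd: "bdd_below (h x ` {0..})" for x
    using lower by (auto intro!: bdd_belowI2)
  have le_h: "q' x \<le> h x t" if "t \<ge> 0" for x t
    unfolding q'_def by (rule cINF_lower[OF bdd]) (use that in auto)
  have greatest: "a \<le> q' x" if "\<And>t. t \<ge> 0 \<Longrightarrow> a \<le> h x t" for a x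
    unfolding q'_def by (rule cINF_greatest) (use that in auto)
  have "sublinear q'"
  proof (rule sublinearI)
    fix x z
    have "q' (x + z) \<le> h x s + h z t" if "s \<ge> 0" "t \<ge> 0" for s t
    proof -
      have "q' (x + z) \<le> h (x + z) (s + t)" using le_h that by simp
      also have "\<dots> \<le> h x s + h z t"
        using sublinear_add[OF q, of "x + s *\<^sub>R y" "z + t *\<^sub>R y"]
        by (simp add: h_def algebra_simps)
      finally show ?thesis .
    qed
    \<comment> \<open>The two infima are taken one after the other: first over \<open>t\<close> with
      \<open>s\<close> fixed, then over \<open>s\<close>.\<close>
    then have "q' (x + z) - h x s \<le> q' z" if "s \<ge> 0" for s
      using that by (intro greatest) (simp add: algebra_simps)
    then have "q' (x + z) - q' z \<le> q' x"
      by (intro greatest) (simp add: algebra_simps)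
    then show "q' (x + z) \<le> q' x + q' z" by simp
  next
    fix x and r :: real assume r: "r > 0"
    have "inverse r * q' (r *\<^sub>R x) \<le> h x t" if "t \<ge> 0" for t
    proof -
      have "q' (r *\<^sub>R x) \<le> h (r *\<^sub>R x) (r * t)" using le_h that r by simp
      also have "\<dots> = r * h x t"
        using sublinear_scale[OF q, of r "x + t *\<^sub>R y"] r by (simp add: h_def algebra_simps)
      finally show ?thesis using r by (simp add: field_simps)
    qed
    then have "inverse r * q' (r *\<^sub>R x) \<le> q' x" by (rule greatest)
    then show "q' (r *\<^sub>R x) \<le> r * q' x" using r by (simp add: field_simps)
  qed
  moreover have "q' \<le> q" using le_h[of 0] by (auto simp: le_fun_def h_def)
  moreover have "q' (- y) \<le> - q y"
    using le_h[of 1 "- y"] sublinear_zero[OF q] by (simp add: h_def)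
  ultimately show ?thesis by (rule that)
qed

text \<open>Zorn's lemma for the reversed pointwise order. The bound of a nonempty chain is its
  pointwise infimum, finite because every member satisfies \<open>- p (- x) \<le> q x\<close>; for
  subadditivity, the smaller of two chain members estimates both terms at once.\<close>

lemma sublinear_minimal:
  fixes p :: "'a::real_vector \<Rightarrow> real"
  assumes p: "sublinear p"
  obtains m where "sublinear m" "m \<le> p" "\<forall>q. sublinear q \<longrightarrow> q \<le> m \<longrightarrow> q = m"
proof -
  define A where "A = {q. sublinear q \<and> q \<le> p}"
  define P where "P = (\<lambda>q r :: 'a \<Rightarrow> real. r \<le> q)"
  have "\<exists>m\<in>A. \<forall>a\<in>A. P m a \<longrightarrow> a = m"
  proof (rule predicate_Zorn)
    show "partial_order_on A (relation_of P A)"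
      by (rule partial_order_on_relation_ofI) (auto simp: P_def)
    fix C assume "C \<in> Chains (relation_of P A)"
    then have CA: "C \<subseteq> A" and chain: "\<And>q r. q \<in> C \<Longrightarrow> r \<in> C \<Longrightarrow> q \<le> r \<or> r \<le> q"
      by (auto simp: Chains_def relation_of_def P_def)
    show "\<exists>u\<in>A. \<forall>a\<in>C. P a u"
    proof (cases "C = {}")
      case True
      then show ?thesis using p by (auto simp: A_def)
    next
      case False
      define u where "u x = (INF q\<in>C. q x)" for x
      have bdd: "bdd_below ((\<lambda>q. q x) ` C)" for x
      proof (rule bdd_belowI2)
        fix q assume "q \<in> C"
        then have "sublinear q" "q \<le> p" using CA by (auto simp: A_def)
        then show "- p (- x) \<le> q x"
          using sublinear_minus_le[of q x] by (auto simp: le_fun_def intro: order_trans[rotated])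
      qed
      have le: "u x \<le> q x" if "q \<in> C" for q x
        unfolding u_def by (rule cINF_lower[OF bdd that])
      have greatest: "a \<le> u x" if "\<And>q. q \<in> C \<Longrightarrow> a \<le> q x" for a x
        unfolding u_def by (rule cINF_greatest[OF False that])
      have "sublinear u"
      proof (rule sublinearI)
        fix x y
        have "u (x + y) \<le> q x + r y" if qr: "q \<in> C" "r \<in> C" for q r
        proof -
          obtain s where s: "s \<in> C" "s \<le> q" "s \<le> r" using chain[OF qr] qr by auto
          have "u (x + y) \<le> s (x + y)" using le s by simp
          also have "\<dots> \<le> s x + s y" using s CA by (intro sublinear_add) (auto simp: A_def)
          also have "\<dots> \<le> q x + r y" using s by (intro add_mono) (auto simp: le_fun_def)
          finally show ?thesis .
        qed
        then have "u (x + y) - q x \<le> r y" if "q \<in> C" "r \<in> C" for q r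
          using that by (simp only: diff_le_eq add.commute)
        then have "u (x + y) - q x \<le> u y" if "q \<in> C" for q
          using that by (intro greatest)
        then have "u (x + y) - u y \<le> q x" if "q \<in> C" for q
          using that by (simp add: diff_le_eq add.commute)
        then have "u (x + y) - u y \<le> u x" by (rule greatest)
        then show "u (x + y) \<le> u x + u y" by simp
      next
        fix x and t :: real assume t: "t > 0"
        have "inverse t * u (t *\<^sub>R x) \<le> q x" if "q \<in> C" for q
        proof -
          have "u (t *\<^sub>R x) \<le> q (t *\<^sub>R x)" using le that .
          also have "\<dots> = t * q x" using CA that t by (intro sublinear_scale) (auto simp: A_def)
          finally show ?thesis using t by (simp add: field_simps)
        qed
        then have "inverse t * u (t *\<^sub>R x) \<le> u x" by (rule greatest)
        then show "u (t *\<^sub>R x) \<le> t * u x" using t by (simp add: field_simps)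
      qed
      moreover have "u \<le> p"
      proof -
        obtain q where q: "q \<in> C" using False by blast
        then have "u \<le> q" using le by (simp add: le_fun_def)
        also have "q \<le> p" using q CA by (auto simp: A_def)
        finally show ?thesis .
      qed
      ultimately have "u \<in> A" by (simp add: A_def)
      then show ?thesis using le by (auto simp: P_def le_fun_def)
    qed
  qed
  then obtain m where m: "m \<in> A" "\<And>q. q \<in> A \<Longrightarrow> q \<le> m \<Longrightarrow> q = m" by (auto simp: P_def)
  show ?thesis
  proof (rule that)
    show "sublinear m" "m \<le> p" using m(1) by (auto simp: A_def)
    show "\<forall>q. sublinear q \<longrightarrow> q \<le> m \<longrightarrow> q = m"
    proof (intro allI impI)
      fix q assume "sublinear q" and le: "q \<le> m"
      moreover have "q \<le> p" using le m(1) by (auto simp: A_def)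
      ultimately show "q = m" using m(2) by (simp add: A_def)
    qed
  qed
qed

text \<open>A minimal sublinear functional is odd, and an odd sublinear functional is linear. To
  obtain equality at \<open>y\<close>, \<open>p\<close> is first decreased to \<open>p'\<close> with
  \<open>p' (- y) \<le> - p y\<close>; a minimal \<open>m\<close> below \<open>p'\<close> then has
  \<open>m y = - m (- y) \<ge> p y\<close>.\<close>

theorem hahn_banach_sublinear:
  fixes p :: "'a::real_vector \<Rightarrow> real"
  assumes p: "sublinear p"
  obtains f where "linear f" "\<forall>x. f x \<le> p x" "f y = p y"
proof -
  obtain p' where p': "sublinear p'" "p' \<le> p" "p' (- y) \<le> - p y"
    by (rule sublinear_decrease[OF p])
  obtain m where m: "sublinear m" "m \<le> p'" "\<forall>q. sublinear q \<longrightarrow> q \<le> m \<longrightarrow> q = m"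
    by (rule sublinear_minimal[OF p'(1)])
  have minus: "m (- x) = - m x" for x
  proof -
    obtain q where "sublinear q" "q \<le> m" "q (- x) \<le> - m x"
      by (rule sublinear_decrease[OF m(1)])
    then have "m (- x) \<le> - m x" using m(3) by blast
    then show ?thesis using sublinear_minus_le[OF m(1), of x] by simp
  qed
  have "linear m"
  proof (rule linearI)
    show "m (x + z) = m x + m z" for x z
      using sublinear_add[OF m(1), of x z] sublinear_add[OF m(1), of "x + z" "- z"]
      by (simp add: minus)
    show "m (t *\<^sub>R x) = t *\<^sub>R m x" for t x
      using sublinear_scale[OF m(1), of t x] sublinear_scale[OF m(1), of "- t" x]
      by (cases "t \<ge> 0") (simp_all add: minus)
  qed
  moreover have le: "\<forall>x. m x \<le> p x"
    using m(2) p'(2) by (auto simp: le_fun_def intro: order_trans)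
  moreover have "m y = p y"
  proof -
    have "m (- y) \<le> p' (- y)" using m(2) by (simp add: le_fun_def)
    then show ?thesis using p'(3) le[rule_format, of y] by (simp add: minus)
  qed
  ultimately show ?thesis by (rule that)
qed

lemma hahn_banach_norming:
  fixes y :: "'a::real_normed_vector"
  obtains f :: "'a \<Rightarrow>\<^sub>L real" where "norm f \<le> 1" "blinfun_apply f y = norm y"
proof -
  have "sublinear (norm :: 'a \<Rightarrow> real)"
    by (rule sublinearI) (auto intro: norm_triangle_ineq)
  then obtain f :: "'a \<Rightarrow> real" where f: "linear f" "\<forall>x. f x \<le> norm x" "f y = norm y"
    by (rule hahn_banach_sublinear[where y = y])
  have le: "norm (f x) \<le> 1 * norm x" for x
    using f(2)[rule_format, of x] f(2)[rule_format, of "- x"] linear_neg[OF f(1), of x] by simp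
  have bl: "bounded_linear f"
    using f(1) le by (intro bounded_linear_intro[of _ 1]) (auto simp: linear_add linear_scale)
  show ?thesis
  proof (rule that)
    show "norm (Blinfun f) \<le> 1"
      by (rule norm_blinfun_bound) (use le bl in \<open>auto simp: bounded_linear_Blinfun_apply\<close>)
    show "blinfun_apply (Blinfun f) y = norm y"
      using f(3) bl by (simp add: bounded_linear_Blinfun_apply)
  qed
qed

subsection \<open>Scalars and dual spaces\<close>

lemma real_or_complex_embedding:
  obtains \<phi> :: "'k::real_or_complex \<Rightarrow> complex" where "\<forall>x y. \<phi> (x + y) = \<phi> x + \<phi> y"
    "\<forall>x y. \<phi> (x * y) = \<phi> x * \<phi> y" "\<forall>r. \<phi> (of_real r) = of_real r"
    "\<forall>x y. dist (\<phi> x) (\<phi> y) = dist x y" "range \<phi> = \<real> \<or> range \<phi> = UNIV"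
proof -
  obtain \<phi> :: "'k \<Rightarrow> complex" where add: "\<And>x y. \<phi> (x + y) = \<phi> x + \<phi> y"
    and mult: "\<And>x y. \<phi> (x * y) = \<phi> x * \<phi> y" and scale: "\<And>r x. \<phi> (r *\<^sub>R x) = r *\<^sub>R \<phi> x"
    and norm: "\<And>x. norm (\<phi> x) = norm x" and range: "range \<phi> = \<real> \<or> range \<phi> = UNIV"
    using real_or_complex by blast
  \<comment> \<open>The class does not postulate that \<phi> is unital, but \<open>\<phi> 1\<close>
    is a nonzero idempotent of a field.\<close>
  have "\<phi> 1 * \<phi> 1 = \<phi> 1 * 1" using mult[of 1 1] by simp
  moreover have "\<phi> 1 \<noteq> 0" using norm[of 1] by auto
  ultimately have one: "\<phi> 1 = 1" by (metis mult_left_cancel)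
  show ?thesis
  proof (rule that)
    show "\<forall>x y. \<phi> (x + y) = \<phi> x + \<phi> y" "\<forall>x y. \<phi> (x * y) = \<phi> x * \<phi> y"
      "range \<phi> = \<real> \<or> range \<phi> = UNIV"
      using add mult range by auto
    show "\<forall>r. \<phi> (of_real r) = of_real r"
      by (simp add: of_real_def scale one)
    have "dist (\<phi> x) (\<phi> y) = dist x y" for x y
      using add[of "x - y" y] norm[of "x - y"] by (simp add: dist_norm)
    then show "\<forall>x y. dist (\<phi> x) (\<phi> y) = dist x y" by blast
  qed
qed

text \<open>This case split provides an imaginary unit inside the abstract field, as needed to pass
  from real-linear functionals to functionals linear over \<open>'k\<close>.\<close>

lemma real_or_complex_cases:
  obtains (real) "\<And>c :: 'k::real_or_complex. \<exists>r. c = of_real r"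
  | (complex) i :: "'k::real_or_complex"
    where "i * i = -1" "\<And>c :: 'k. \<exists>a b. c = of_real a + of_real b * i"
proof -
  obtain \<phi> :: "'k \<Rightarrow> complex" where \<phi>: "\<forall>x y. \<phi> (x + y) = \<phi> x + \<phi> y"
    "\<forall>x y. \<phi> (x * y) = \<phi> x * \<phi> y" "\<forall>r. \<phi> (of_real r) = of_real r"
    "\<forall>x y. dist (\<phi> x) (\<phi> y) = dist x y" "range \<phi> = \<real> \<or> range \<phi> = UNIV"
    by (rule real_or_complex_embedding)
  have inj: "x = y" if "\<phi> x = \<phi> y" for x y
    using \<phi>(4)[rule_format, of x y] that by simp
  from \<phi>(5) show ?thesis
  proof
    assume R: "range \<phi> = \<real>"
    show ?thesis
    proof (rule real)
      fix c
      have "\<phi> c \<in> \<real>" using R by blast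
      then obtain r where "\<phi> c = of_real r" by (auto simp: Reals_def)
      then show "\<exists>r. c = of_real r" using inj \<phi>(3) by metis
    qed
  next
    assume "range \<phi> = UNIV"
    then obtain i where i: "\<phi> i = \<i>" by (metis UNIV_I imageE)
    show ?thesis
    proof (rule complex)
      show "i * i = -1"
        by (rule inj) (use \<phi>(3)[rule_format, of "-1"] in \<open>simp add: \<phi>(2) i\<close>)
      fix c
      have "c = of_real (Re (\<phi> c)) + of_real (Im (\<phi> c)) * i"
        by (rule inj) (simp add: \<phi>(1-3) i complex_eq mult.commute)
      then show "\<exists>a b. c = of_real a + of_real b * i" by blast
    qed
  qed
qed

text \<open>The embedding into \<open>complex\<close> is isometric with closed range, so the ball is
  the continuous image, under the inverse, of a compact set.\<close>

lemma compact_cball_real_or_complex: "compact (cball (0 :: 'k::real_or_complex) r)"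
proof -
  obtain \<phi> :: "'k \<Rightarrow> complex" where \<phi>: "\<forall>x y. \<phi> (x + y) = \<phi> x + \<phi> y"
    "\<forall>x y. \<phi> (x * y) = \<phi> x * \<phi> y" "\<forall>r. \<phi> (of_real r) = of_real r"
    "\<forall>x y. dist (\<phi> x) (\<phi> y) = dist x y" "range \<phi> = \<real> \<or> range \<phi> = UNIV"
    by (rule real_or_complex_embedding)
  have inv: "inv \<phi> (\<phi> x) = x" for x
    using \<phi>(4) by (intro inv_f_f injI) (metis dist_eq_0_iff)
  have zero: "\<phi> 0 = 0" using \<phi>(3)[rule_format, of 0] by simp
  have "cball 0 r = inv \<phi> ` (cball 0 r \<inter> range \<phi>)" (is "?L = ?R")
  proof
    show "?L \<subseteq> ?R"
    proof
      fix x assume "x \<in> ?L"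
      then have "\<phi> x \<in> cball 0 r \<inter> range \<phi>" using \<phi>(4)[rule_format, of 0 x] by (simp add: zero)
      then show "x \<in> ?R" using inv[of x] by force
    qed
    show "?R \<subseteq> ?L" using \<phi>(4)[rule_format, of 0] by (auto simp: zero inv)
  qed
  moreover have "closed (range \<phi>)" using \<phi>(5) by (auto simp: closed_complex_Reals)
  then have "compact (cball 0 r \<inter> range \<phi>)" by (intro compact_Int_closed compact_cball)
  moreover have "continuous_on (cball 0 r \<inter> range \<phi>) (inv \<phi>)"
  proof (rule continuous_on_subset)
    show "continuous_on (range \<phi>) (inv \<phi>)"
      unfolding continuous_on_iff by (auto simp: inv \<phi>(4))
  qed simp
  ultimately show ?thesis using compact_continuous_image by metis
qed

section \<open>Unit scalars that align phases\<close>

lemma exists_unit_norm_mult: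
  fixes c :: "'k::real_normed_field"
  obtains u where "norm u = 1" "u * c = of_real (norm c)"
proof (cases "c = 0")
  case True
  then show ?thesis using that[of 1] by simp
next
  case False
  then show ?thesis using that[of "of_real (norm c) / c"] by (simp add: norm_divide)
qed

text \<open>If \<open>v\<close> and \<open>w\<close> turn \<open>a\<close> and \<open>b\<close> into
  nonnegative reals, then \<open>w / v\<close> gives \<open>b\<close> the phase of \<open>a\<close>,
  and the triangle inequality becomes an equality for every \<open>t \<ge> 0\<close>
  simultaneously.\<close>

lemma exists_unit_norm_add:
  fixes a b :: "'k::real_normed_field"
  obtains u where "norm u = 1" "\<forall>t\<ge>0. norm (a + t *\<^sub>R (u * b)) = norm a + t * norm b"
proof -
  obtain v where v: "norm v = 1" "v * a = of_real (norm a)" by (rule exists_unit_norm_mult)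
  obtain w where w: "norm w = 1" "w * b = of_real (norm b)" by (rule exists_unit_norm_mult)
  have v0: "v \<noteq> 0" using v(1) by auto
  show ?thesis
  proof (rule that)
    show "norm (w / v) = 1" using v w by (simp add: norm_divide)
    show "\<forall>t\<ge>0. norm (a + t *\<^sub>R (w / v * b)) = norm a + t * norm b"
    proof (intro allI impI)
      fix t :: real assume t: "t \<ge> 0"
      have "norm (a + t *\<^sub>R (w / v * b)) = norm (v * (a + t *\<^sub>R (w / v * b)))"
        by (simp add: norm_mult v)
      also have "v * (a + t *\<^sub>R (w / v * b)) = of_real (norm a) + t *\<^sub>R (w * b)"
        using v0 by (simp add: distrib_left v(2))
      also have "\<dots> = of_real (norm a + t * norm b)"
        by (simp add: w(2) scaleR_conv_of_real)
      also have "norm \<dots> = norm a + t * norm b" using t by (simp only: norm_of_real) simp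
      finally show "norm (a + t *\<^sub>R (w / v * b)) = norm a + t * norm b" .
    qed
  qed
qed

lemma vector_space_mult: "vector_space ((*) :: 'k::field \<Rightarrow> 'k \<Rightarrow> 'k)"
  by unfold_locales (auto simp: algebra_simps)

section \<open>Functionals linear over the scalar field\<close>

lemma mem_dual_iff:
  assumes "normed_space_over s"
  shows "f \<in> dual s \<longleftrightarrow> (\<forall>c x. blinfun_apply f (s c x) = c * blinfun_apply f x)"
  using normed_space_over.axioms(1)[OF assms] vector_space_mult
  by (auto simp: dual_def bounded_ops_def Vector_Spaces.linear_iff blinfun.add_right)

text \<open>A real functional \<open>w\<close> norming \<open>y\<close> comes from Hahn-Banach. In
  the complex case it is complexified by the usual formula
  \<open>f x = w x - i * w (i x)\<close>.\<close>

lemma dual_nontrivial: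
  fixes s :: "'k::real_or_complex \<Rightarrow> 'a::real_normed_vector \<Rightarrow> 'a"
    and y :: 'a
  assumes s: "normed_space_over s" and y: "y \<noteq> 0"
  obtains f where "f \<in> dual s" "f \<noteq> 0"
proof -
  interpret normed_space_over s by fact
  obtain w :: "'a \<Rightarrow>\<^sub>L real" where w: "blinfun_apply w y = norm y"
    by (rule hahn_banach_norming)
  have bounded: "bounded_linear (s c)" for c
  proof (rule bounded_linear_intro)
    show "s c (x + z) = s c x + s c z" for x z by (rule scale_right_distrib)
    show "s c (r *\<^sub>R x) = r *\<^sub>R s c x" for r x
      by (metis scale_left_commute scale_of_real)
    show "norm (s c x) \<le> norm x * norm c" for x by (simp add: norm_scale mult.commute)
  qed
  show ?thesis
  proof (cases rule: real_or_complex_cases[where ?'k = 'k])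
    case real
    define f where "f = Blinfun (\<lambda>x. of_real (w x) :: 'k)"
    have "bounded_linear (\<lambda>x. of_real (w x) :: 'k)"
      by (intro bounded_linear_compose[OF bounded_linear_of_real] blinfun.bounded_linear_right)
    then have f: "blinfun_apply f x = of_real (w x)" for x
      by (simp add: f_def bounded_linear_Blinfun_apply)
    show ?thesis
    proof (rule that)
      show "f \<in> dual s"
        unfolding mem_dual_iff[OF s]
      proof (intro allI)
        fix c :: 'k and x
        obtain r where "c = of_real r" using real by blast
        then show "f (s c x) = c * f x"
          by (simp add: f scale_of_real blinfun.scaleR_right scaleR_conv_of_real)
      qed
      have "f y \<noteq> 0" using y by (simp add: f w)
      then show "f \<noteq> 0" by auto
    qed
  next
    case (complex i)
    define f where "f = Blinfun (\<lambda>x. of_real (w x) - i * of_real (w (s i x)) :: 'k)"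
    have "bounded_linear (\<lambda>x. of_real (w x) - i * of_real (w (s i x)) :: 'k)"
      by (intro bounded_linear_intros bounded_linear_compose[OF bounded_linear_of_real]
          bounded_linear_compose[OF _ bounded])
    then have f: "blinfun_apply f x = of_real (w x) - i * of_real (w (s i x))" for x
      by (simp add: f_def bounded_linear_Blinfun_apply)
    show ?thesis
    proof (rule that)
      show "f \<in> dual s"
        unfolding mem_dual_iff[OF s]
      proof (intro allI)
        fix c x
        obtain a b where c: "c = of_real a + of_real b * i" using complex(2) by blast
        have cx: "s c x = a *\<^sub>R x + b *\<^sub>R s i x"
          by (simp add: c scale_left_distrib flip: scale_scale scale_of_real)
        have "i * c = of_real a * i + of_real b * (i * i)" by (simp add: c algebra_simps)
        then have "i * c = of_real a * i - of_real b" by (simp add: complex(1))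
        then have "s i (s c x) = s (of_real a * i) x - s (of_real b) x"
          by (simp add: scale_left_diff_distrib)
        also have "\<dots> = a *\<^sub>R s i x - b *\<^sub>R x"
          by (simp flip: scale_scale add: scale_of_real)
        finally have icx: "s i (s c x) = a *\<^sub>R s i x - b *\<^sub>R x" .
        have ii: "i * (i * t) = - t" for t using complex(1) by (simp flip: mult.assoc)
        have "f (s c x) = of_real a * of_real (w x) + of_real b * of_real (w (s i x)) -
            i * (of_real a * of_real (w (s i x)) - of_real b * of_real (w x))"
          by (simp only: f icx) (simp add: cx blinfun.bilinear_simps)
        also have "\<dots> = (of_real a + of_real b * i) * (of_real (w x) - i * of_real (w (s i x)))"
          by (simp add: algebra_simps ii)
        finally show "f (s c x) = c * f x" by (simp only: c f)
      qed
      \<comment> \<open>Real parts are replaced by squaring: equality would make the square of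
        \<open>norm y\<close> equal to minus a real square.\<close>
      have "of_real (norm y) \<noteq> i * of_real (w (s i y))"
      proof
        assume eq: "of_real (norm y) = i * of_real (w (s i y))"
        have "of_real (norm y * norm y) = (i * of_real (w (s i y))) * (i * of_real (w (s i y)))"
          by (simp flip: eq)
        also have "\<dots> = (i * i) * of_real (w (s i y) * w (s i y))"
          by (simp add: ac_simps)
        also have "\<dots> = of_real (- (w (s i y) * w (s i y)))"
          by (simp add: complex(1))
        finally have "norm y * norm y = - (w (s i y) * w (s i y))" by (simp only: of_real_eq_iff)
        then have "norm y * norm y \<le> 0" using zero_le_square[of "w (s i y)"] by linarith
        then show False using y by (simp add: mult_le_0_iff)
      qed
      then have "f y \<noteq> 0" by (simp add: f w)
      then show "f \<noteq> 0" by auto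
    qed
  qed
qed

lemma dual_norm_eq:
  fixes s :: "'k::real_or_complex \<Rightarrow> 'a::real_normed_vector \<Rightarrow> 'a"
    and y :: 'a
  assumes s: "normed_space_over s" and "y \<noteq> 0" and "r \<ge> 0"
  obtains f where "f \<in> dual s" "norm f = r"
proof -
  obtain g where g: "g \<in> dual s" "g \<noteq> 0" by (rule dual_nontrivial[OF assms(1,2)])
  show ?thesis
  proof (rule that)
    show "(r / norm g) *\<^sub>R g \<in> dual s"
      using g(1) by (simp add: mem_dual_iff[OF s] blinfun.bilinear_simps)
    show "norm ((r / norm g) *\<^sub>R g) = r" using g(2) assms(3) by simp
  qed
qed

text \<open>Tychonoff compactness in the style of Banach-Alaoglu. The scalars \<open>z n\<close> are
  carried along as an extra coordinate so that both limits exist along the same filter. Linearity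
  and the bound \<open>L\<close> pass to pointwise limits, which puts the cluster point in the
  dual.\<close>

lemma weak_star_cluster:
  fixes s :: "'k::real_or_complex \<Rightarrow> 'b::real_normed_vector \<Rightarrow> 'b"
    and z :: "nat \<Rightarrow> 'k"
  assumes s: "normed_space_over s"
    and f: "\<And>n. f n \<in> dual s" "\<And>n. norm (f n) \<le> L" and z: "\<And>n. norm (z n) \<le> C"
  obtains F u \<zeta> where "F \<noteq> bot" "F \<le> sequentially" "u \<in> dual s"
    "\<forall>y. ((\<lambda>n. blinfun_apply (f n) y) \<longlongrightarrow> blinfun_apply u y) F" "(z \<longlongrightarrow> \<zeta>) F"
proof -
  define g where "g n = (blinfun_apply (f n), z n)" for n
  define K where "K = PiE UNIV (\<lambda>y::'b. cball (0::'k) (L * norm y)) \<times> cball (0::'k) C"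
  have "compactin (product_topology (\<lambda>_. euclidean) UNIV)
      (PiE UNIV (\<lambda>y::'b. cball (0::'k) (L * norm y)))"
    by (simp add: compactin_PiE compact_cball_real_or_complex)
  then have "compact (PiE UNIV (\<lambda>y::'b. cball (0::'k) (L * norm y)))"
    by (simp add: euclidean_product_topology)
  then have "compact K"
    unfolding K_def by (intro compact_Times compact_cball_real_or_complex)
  moreover have gK: "g n \<in> K" for n
    using order_trans[OF norm_blinfun[of "f n"] mult_right_mono[OF f(2)[of n] norm_ge_zero]] z
    by (auto simp: g_def K_def)
  moreover have "filtermap g sequentially \<noteq> bot" by (simp add: filtermap_bot_iff)
  moreover have "eventually (\<lambda>q. q \<in> K) (filtermap g sequentially)"
    using gK by (simp add: eventually_filtermap)
  ultimately obtain p where p: "inf (nhds p) (filtermap g sequentially) \<noteq> bot"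
    unfolding compact_filter by meson
  \<comment> \<open>This filter plays the role of a subnet: it forces \<open>g\<close> to converge
    to \<open>p\<close>, and being finer than \<open>sequentially\<close> it keeps every property
    that holds for all large \<open>n\<close>.\<close>
  define F where "F = inf (filtercomap g (nhds p)) sequentially"
  have "F \<noteq> bot"
  proof
    assume "F = bot"
    then have "eventually (\<lambda>_. False) F" by simp
    then obtain P Q where PQ: "eventually P (filtercomap g (nhds p))" "eventually Q sequentially"
      "\<And>x. P x \<Longrightarrow> Q x \<Longrightarrow> False" unfolding F_def eventually_inf by auto
    then obtain R where R: "eventually R (nhds p)" "\<And>x. R (g x) \<Longrightarrow> P x"
      unfolding eventually_filtercomap by auto
    have "eventually (\<lambda>y. \<not> R y) (filtermap g sequentially)"
      unfolding eventually_filtermap using PQ(2) by eventually_elim (use R(2) PQ(3) in blast)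
    then have "eventually (\<lambda>_. False) (inf (nhds p) (filtermap g sequentially))"
      unfolding eventually_inf using R(1) by blast
    then show False using p by (simp add: trivial_limit_def)
  qed
  have "filterlim g (nhds p) F"
    unfolding F_def by (rule filterlim_mono[OF filterlim_filtercomap order_refl inf_le1])
  then have "((\<lambda>n. fst (g n)) \<longlongrightarrow> fst p) F" "((\<lambda>n. snd (g n)) \<longlongrightarrow> snd p) F"
    by (auto intro: tendsto_fst tendsto_snd)
  then have lim: "\<And>y. ((\<lambda>n. f n y) \<longlongrightarrow> fst p y) F" and limz: "(z \<longlongrightarrow> snd p) F"
    using limitin_componentwise[of "\<lambda>_::'b. euclidean :: 'k topology" UNIV
        "\<lambda>n. blinfun_apply (f n)" "fst p" F]
    by (simp_all add: g_def euclidean_product_topology)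
  have uniq: "a = b" if "(h \<longlongrightarrow> a) F" "(h \<longlongrightarrow> b) F" for h :: "nat \<Rightarrow> 'k" and a b
    using tendsto_unique[OF \<open>F \<noteq> bot\<close> that] .
  have fs: "f n (s c x) = c * f n x" for n c x using f(1) mem_dual_iff[OF s] by blast
  have ps: "fst p (s c x) = c * fst p x" for c x
    using lim[of "s c x"] tendsto_mult_left[OF lim[of x], of c]
    by (intro uniq[of "\<lambda>n. c * f n x"]) (simp_all add: fs)
  have bl: "bounded_linear (fst p)"
  proof (rule bounded_linear_intro)
    show "fst p (x + y) = fst p x + fst p y" for x y
      using lim[of "x + y"] tendsto_add[OF lim[of x] lim[of y]]
      by (intro uniq[of "\<lambda>n. f n x + f n y"]) (simp_all add: blinfun.bilinear_simps)
    show "fst p (r *\<^sub>R x) = r *\<^sub>R fst p x" for r x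
      using ps[of "of_real r" x] normed_space_over.scale_of_real[OF s, of r x]
      by (simp add: scaleR_conv_of_real)
    show "norm (fst p x) \<le> norm x * L" for x
    proof (rule tendsto_upperbound[OF tendsto_norm[OF lim] _ \<open>F \<noteq> bot\<close>])
      have "norm (f n x) \<le> norm x * L" for n
        using norm_blinfun[of "f n" x] mult_right_mono[OF f(2)[of n] norm_ge_zero[of x]]
        by (simp add: mult.commute)
      then show "\<forall>\<^sub>F n in F. norm (f n x) \<le> norm x * L" by simp
    qed
  qed
  show ?thesis
  proof (rule that)
    show "F \<noteq> bot" by fact
    show "F \<le> sequentially" by (simp add: F_def)
    show "(z \<longlongrightarrow> snd p) F" by fact
    show "Blinfun (fst p) \<in> dual s" by (simp add: mem_dual_iff[OF s] bounded_linear_Blinfun_apply bl ps)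
    show "\<forall>y. ((\<lambda>n. f n y) \<longlongrightarrow> Blinfun (fst p) y) F"
      using lim by (simp add: bounded_linear_Blinfun_apply bl)
  qed
qed

subsection \<open>The perturbed maximization problem\<close>

lemma exists_near_norm_blinfun:
  fixes f :: "'a::real_normed_vector \<Rightarrow>\<^sub>L 'b::real_normed_vector"
  assumes "\<epsilon> > 0"
  obtains y where "norm y \<le> 1" "norm f - \<epsilon> \<le> norm (blinfun_apply f y)"
proof (rule ccontr)
  assume "\<not> thesis"
  then have less: "norm (f y) < norm f - \<epsilon>" if "norm y \<le> 1" for y
    using that \<open>\<And>y. norm y \<le> 1 \<Longrightarrow> norm f - \<epsilon> \<le> norm (f y) \<Longrightarrow> thesis\<close> by force
  have nonneg: "norm f - \<epsilon> \<ge> 0" using less[of 0] by simp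
  have "norm f \<le> norm f - \<epsilon>"
  proof (rule norm_blinfun_bound[OF nonneg])
    fix x :: 'a
    show "norm (f x) \<le> (norm f - \<epsilon>) * norm x"
    proof (cases "x = 0")
      case False
      then have "norm (f (x /\<^sub>R norm x)) \<le> norm f - \<epsilon>" by (intro less[THEN less_imp_le]) simp
      then show ?thesis using False by (simp add: blinfun.scaleR_right field_simps)
    qed simp
  qed
  then show False using assms by simp
qed

lemma exists_near_maximum:
  fixes g :: "'a \<Rightarrow> real"
  assumes "A \<noteq> {}" "bdd_above (g ` A)" "\<epsilon> > 0"
  obtains x where "x \<in> A" "\<forall>x'\<in>A. g x' \<le> g x + \<epsilon>"
proof -
  have "Sup (g ` A) - \<epsilon> < Sup (g ` A)" using assms(3) by simp
  then obtain x where x: "x \<in> A" "Sup (g ` A) - \<epsilon> < g x"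
    using less_cSup_iff[of "g ` A" "Sup (g ` A) - \<epsilon>"] assms(1,2) by auto
  show ?thesis
  proof (rule that[OF x(1)], rule ballI)
    fix x' assume "x' \<in> A"
    then have "g x' \<le> Sup (g ` A)" using assms(2) by (intro cSup_upper) auto
    then show "g x' \<le> g x + \<epsilon>" using x(2) by linarith
  qed
qed

text \<open>The maximization is perturbed only through \<open>w\<close>, the limit of partial sums
  of steps along almost norming vectors \<open>y k\<close>; completeness of \<open>'b\<close>
  supplies this limit. Each step rewards points at which \<open>T x\<close> is large in the
  direction \<open>y k\<close>, so all later near-maximizers must be large there too.\<close>

lemma perturbed_optimization:
  fixes sX :: "'k::real_or_complex \<Rightarrow> 'a::real_normed_vector \<Rightarrow> 'a"
    and sY :: "'k \<Rightarrow> 'b::banach \<Rightarrow> 'b"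
    and T :: "'a \<Rightarrow>\<^sub>L 'b \<Rightarrow>\<^sub>L 'k" and z :: "'a \<Rightarrow>\<^sub>L 'k"
  defines "G \<equiv> \<lambda>w x. norm (T x) + norm (z x + T x w)"
  assumes sY: "normed_space_over sY" and T: "\<And>x. blinfun_apply T x \<in> dual sY" and c: "c > 0"
  obtains w x y \<delta> where "norm w \<le> 2 * c"
    "\<forall>n. norm (x n) \<le> 1" "\<forall>n. norm (y n) \<le> 1" "\<delta> \<longlonglongrightarrow> 0"
    "\<forall>k. \<forall>m>k. norm (T (x k)) - \<delta> k \<le> norm (T (x m) (y k))"
    "\<forall>k x'. norm x' \<le> 1 \<longrightarrow> G w x' \<le> G w (x k) + \<delta> k"
proof -
  define L where "L = norm T"
  have L: "L \<ge> 0" by (simp add: L_def)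
  \<comment> \<open>The steps decrease superexponentially, so that all later steps together are negligible
    compared with \<open>lam k\<close>: this is what makes \<open>x m\<close> remember the direction \<open>y k\<close> for \<open>m > k\<close>.\<close>
  define lam where "lam k = c / fact (Suc k)" for k
  \<comment> \<open>The tolerance equals the next step size \<open>lam (Suc k)\<close>. Thus the
    maximization error at stage \<open>k\<close> and the total length of all later steps, at most
    \<open>2 * \<epsilon> k\<close>, are both negligible relative to \<open>lam k\<close>.\<close>
  define \<epsilon> where "\<epsilon> k = lam k / (real k + 2)" for k
  have lam_pos: "lam k > 0" for k using c by (simp add: lam_def)
  have \<epsilon>_pos: "\<epsilon> k > 0" for k using lam_pos[of k] by (simp add: \<epsilon>_def)
  have lam_Suc: "lam (Suc k) = \<epsilon> k" for k
    by (simp add: lam_def \<epsilon>_def field_simps)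
  have \<epsilon>_half: "2 * \<epsilon> k \<le> lam k" for k
    using lam_pos[of k] by (simp add: \<epsilon>_def field_simps)
  have Tx: "norm (T x) \<le> L" if "norm x \<le> 1" for x
    using norm_blinfun[of T x] mult_left_mono[OF that L] by (simp add: L_def)
  have Txw: "norm (T x w) \<le> L * norm w" if "norm x \<le> 1" for x w
    using norm_blinfun[of "T x" w] mult_right_mono[OF Tx[OF that] norm_ge_zero[of w]] by linarith
  have G_lip: "G w x \<le> G w' x + L * norm (w - w')" if "norm x \<le> 1" for w w' x
  proof -
    have "z x + T x w = (z x + T x w') + T x (w - w')" by (simp add: blinfun.bilinear_simps)
    then have "norm (z x + T x w) \<le> norm (z x + T x w') + norm (T x (w - w'))"
      by (metis norm_triangle_ineq)
    then show ?thesis using Txw[OF that, of "w - w'"] by (simp add: G_def)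
  qed
  have "\<exists>x. norm x \<le> 1 \<and> (\<forall>x'. norm x' \<le> 1 \<longrightarrow> G w x' \<le> G w x + \<epsilon> k)" for w k
  proof -
    have "G w x \<le> L + norm z + L * norm w" if "norm x \<le> 1" for x
    proof -
      have "norm (z x) \<le> norm z"
        using norm_blinfun[of z x] mult_left_mono[OF that norm_ge_zero[of z]] by simp
      then show ?thesis
        using Tx[OF that] Txw[OF that, of w] norm_triangle_ineq[of "z x" "T x w"]
        by (simp add: G_def)
    qed
    then have "bdd_above (G w ` cball 0 1)" by (intro bdd_aboveI2) auto
    then obtain x where "x \<in> cball 0 1" "\<forall>x'\<in>cball 0 1. G w x' \<le> G w x + \<epsilon> k"
      by (rule exists_near_maximum[OF _ _ \<epsilon>_pos[of k], rotated]) auto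
    then show ?thesis by (intro exI[of _ x]) auto
  qed
  then obtain X where X: "\<And>w k. norm (X w k) \<le> 1"
    "\<And>w k x'. norm x' \<le> 1 \<Longrightarrow> G w x' \<le> G w (X w k) + \<epsilon> k"
    by metis
  \<comment> \<open>Rotating \<open>y\<close> by a unit scalar aligns \<open>T x y\<close> with \<open>z x + T x w\<close>.\<close>
  define P where "P w k x y \<longleftrightarrow> norm y \<le> 1 \<and> norm (T x) - \<epsilon> k \<le> norm (T x y) \<and>
      (\<forall>t\<ge>0. norm (z x + T x (w + t *\<^sub>R y)) = norm (z x + T x w) + t * norm (T x y))" for w k x y
  have "\<exists>y. P w k x y" for w k x
  proof -
    obtain y where y: "norm y \<le> 1" "norm (T x) - \<epsilon> k \<le> norm (T x y)"
      by (rule exists_near_norm_blinfun[OF \<epsilon>_pos])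
    obtain u where u: "norm u = 1"
      "\<forall>t\<ge>0. norm ((z x + T x w) + t *\<^sub>R (u * T x y)) = norm (z x + T x w) + t * norm (T x y)"
      by (rule exists_unit_norm_add)
    have Tu: "T x (sY u y) = u * T x y" using T[of x] mem_dual_iff[OF sY] by blast
    have "norm (sY u y) \<le> 1"
      using normed_space_over.norm_scale[OF sY, of u y] u(1) y(1) by simp
    moreover have "norm (T x (sY u y)) = norm (T x y)" by (simp add: Tu norm_mult u(1))
    ultimately show ?thesis
      unfolding P_def using y(2) u(2)
      by (intro exI[of _ "sY u y"]) (simp add: Tu blinfun.bilinear_simps add.assoc)
  qed
  then obtain Y where "\<And>w k x. P w k x (Y w k x)" by metis
  then have Y: "norm (Y w k x) \<le> 1" "norm (T x) - \<epsilon> k \<le> norm (T x (Y w k x))"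
    "t \<ge> 0 \<Longrightarrow>
      norm (z x + T x (w + t *\<^sub>R Y w k x)) = norm (z x + T x w) + t * norm (T x (Y w k x))"
    for w k x t
    unfolding P_def by blast+
  define W where "W = rec_nat 0 (\<lambda>k w. w + lam k *\<^sub>R Y w k (X w k))"
  define x where "x k = X (W k) k" for k
  define y where "y k = Y (W k) k (x k)" for k
  have W: "W 0 = 0" "W (Suc k) = W k + lam k *\<^sub>R y k" for k
    by (simp_all add: W_def x_def y_def)
  have xy: "norm (x k) \<le> 1" "norm (y k) \<le> 1" "norm (T (x k)) - \<epsilon> k \<le> norm (T (x k) (y k))" for k
    by (simp_all add: x_def y_def X Y)
  \<comment> \<open>The sum telescopes: since \<open>2 * lam (Suc n) \<le> lam n\<close>, a step of
    length \<open>lam n\<close> is at most \<open>2 * lam n - 2 * lam (Suc n)\<close>.\<close>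
  have W_diff: "norm (W (k + j) - W k) \<le> 2 * lam k - 2 * lam (k + j)" for k j
  proof (induction j)
    case (Suc j)
    have "norm (W (k + Suc j) - W k) \<le> norm (W (k + j) - W k) + norm (lam (k + j) *\<^sub>R y (k + j))"
      using norm_triangle_ineq[of "W (k + j) - W k" "lam (k + j) *\<^sub>R y (k + j)"]
      by (simp add: W algebra_simps)
    moreover have "norm (lam (k + j) *\<^sub>R y (k + j)) \<le> lam (k + j)"
      using lam_pos[of "k + j"] mult_left_mono[OF xy(2)[of "k + j"], of "lam (k + j)"] by simp
    ultimately show ?case using Suc \<epsilon>_half[of "k + j"] by (simp add: lam_Suc)
  qed simp
  have W_diff_le: "norm (W m - W k) \<le> 2 * lam k" if "m \<ge> k" for m k
    using W_diff[of k "m - k"] lam_pos[of m] that by simp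
  have "lam \<longlonglongrightarrow> 0"
  proof -
    have "(\<lambda>k. c * inverse (real (Suc k))) \<longlonglongrightarrow> c * 0"
      by (intro tendsto_mult_left LIMSEQ_inverse_real_of_nat)
    moreover have "lam k \<le> c * inverse (real (Suc k))" for k
    proof -
      have "real (Suc k) \<le> fact (Suc k)" using fact_ge_self[of "Suc k"]
        by (metis of_nat_fact of_nat_le_iff)
      then have "c / fact (Suc k) \<le> c / real (Suc k)" using c by (intro divide_left_mono) auto
      then show ?thesis by (simp add: lam_def divide_inverse)
    qed
    ultimately show ?thesis
      by (intro tendsto_sandwich[OF _ _ tendsto_const, of 0 lam]) (simp_all add: less_imp_le lam_pos)
  qed
  have "Cauchy W"
  proof (rule CauchyI')
    fix e :: real assume "e > 0"
    then have "eventually (\<lambda>k. lam k < e / 2) sequentially"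
      using order_tendstoD(2)[OF \<open>lam \<longlonglongrightarrow> 0\<close>, of "e / 2"] by simp
    then obtain N where N: "\<And>k. k \<ge> N \<Longrightarrow> lam k < e / 2" by (auto simp: eventually_sequentially)
    have "norm (W m - W n) < e" if "m \<ge> N" "n > m" for m n
      using W_diff_le[of m n] N[OF that(1)] that(2) by (simp add: norm_minus_commute)
    then show "\<exists>M. \<forall>m\<ge>M. \<forall>n>m. dist (W m) (W n) < e" unfolding dist_norm by blast
  qed
  then obtain w where w: "W \<longlonglongrightarrow> w" using Cauchy_convergent_iff convergent_def by blast
  have w_diff: "norm (w - W k) \<le> 2 * lam k" for k
  proof (rule tendsto_upperbound[OF tendsto_norm[OF tendsto_diff[OF w tendsto_const]]])
    show "\<forall>\<^sub>F m in sequentially. norm (W m - W k) \<le> 2 * lam k"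
      using eventually_ge_at_top[of k] by eventually_elim (rule W_diff_le)
  qed simp
  \<comment> \<open>The first and last terms cover the error in \<open>key\<close>, the first two
    the error in \<open>max\<close>.\<close>
  define \<delta> where "\<delta> k = \<epsilon> k + 4 * L * lam k + (2 + 4 * L) / (real k + 2)" for k
  \<comment> \<open>Passing from \<open>W k\<close> to \<open>W (Suc k)\<close> raises the value of
    \<open>G\<close> at \<open>x k\<close> by almost \<open>lam k * norm (T (x k))\<close>, by the
    alignment of \<open>y k\<close>, and at \<open>x m\<close> by at most
    \<open>lam k * norm (T (x m) (y k))\<close>. Near-maximality of \<open>x k\<close> for
    \<open>W k\<close> and of \<open>x m\<close> for \<open>W m\<close> makes the two gains
    comparable. The errors are two tolerances and two moves between \<open>W (Suc k)\<close> and
    \<open>W m\<close>, in total \<open>(2 + 4 * L) * \<epsilon> k\<close>; division by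
    \<open>lam k\<close> leaves a null sequence.\<close>
  have key: "norm (T (x k)) - \<delta> k \<le> norm (T (x m) (y k))" if "m > k" for k m
  proof -
    have Wd: "L * norm (W (Suc k) - W m) \<le> L * (2 * \<epsilon> k)"
      "L * norm (W m - W (Suc k)) \<le> L * (2 * \<epsilon> k)"
      using W_diff_le[of "Suc k" m] that L
      by (auto simp: lam_Suc norm_minus_commute intro!: mult_left_mono)
    have "lam (Suc j) \<le> lam j" for j
      using \<epsilon>_half[of j] \<epsilon>_pos[of j] by (simp add: lam_Suc)
    then have "lam m \<le> lam k"
      by (rule lift_Suc_antimono_le) (use that in simp)
    then have \<epsilon>m: "\<epsilon> m \<le> \<epsilon> k"
      using that lam_pos[of m] unfolding \<epsilon>_def by (intro frac_le) auto
    have "G (W k) (x k) + lam k * (norm (T (x k)) - \<epsilon> k) \<le> G (W (Suc k)) (x k)"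
      using Y(3)[of "lam k" "x k" "W k" k] mult_left_mono[OF xy(3)[of k], of "lam k"] lam_pos[of k]
      by (simp add: G_def W flip: y_def)
    also have "\<dots> \<le> G (W m) (x k) + L * (2 * \<epsilon> k)"
      using G_lip[OF xy(1), of "W (Suc k)" k "W m"] Wd by linarith
    also have "G (W m) (x k) \<le> G (W m) (x m) + \<epsilon> k"
      using X(2)[OF xy(1), of "W m" k m] \<epsilon>m by (simp add: x_def)
    also have "G (W m) (x m) \<le> G (W (Suc k)) (x m) + L * (2 * \<epsilon> k)"
      using G_lip[OF xy(1), of "W m" m "W (Suc k)"] Wd by linarith
    also have "G (W (Suc k)) (x m) \<le> G (W k) (x m) + lam k * norm (T (x m) (y k))"
    proof -
      have "z (x m) + T (x m) (W (Suc k)) = (z (x m) + T (x m) (W k)) + lam k *\<^sub>R T (x m) (y k)"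
        by (simp add: W blinfun.bilinear_simps)
      then have "norm (z (x m) + T (x m) (W (Suc k))) \<le>
          norm (z (x m) + T (x m) (W k)) + norm (lam k *\<^sub>R T (x m) (y k))"
        by (simp only: norm_triangle_ineq)
      then show ?thesis using lam_pos[of k] by (simp add: G_def)
    qed
    also have "G (W k) (x m) \<le> G (W k) (x k) + \<epsilon> k"
      using X(2)[OF xy(1), of "W k" m k] by (simp add: x_def)
    finally have "lam k * (norm (T (x k)) - \<epsilon> k) \<le>
        lam k * norm (T (x m) (y k)) + (2 + 4 * L) * \<epsilon> k"
      by (simp add: algebra_simps)
    also have "\<dots> = lam k * (norm (T (x m) (y k)) + (2 + 4 * L) / (real k + 2))"
      by (simp add: \<epsilon>_def add_divide_distrib algebra_simps)
    finally have "norm (T (x k)) - \<epsilon> k \<le> norm (T (x m) (y k)) + (2 + 4 * L) / (real k + 2)"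
      using lam_pos[of k] by simp
    moreover have "4 * L * lam k \<ge> 0" using L lam_pos[of k] by simp
    ultimately show ?thesis unfolding \<delta>_def by linarith
  qed
  have max: "G w x' \<le> G w (x k) + \<delta> k" if "norm x' \<le> 1" for x' k
  proof -
    have wd: "L * norm (w - W k) \<le> L * (2 * lam k)" "L * norm (W k - w) \<le> L * (2 * lam k)"
      using w_diff[of k] L by (auto simp: norm_minus_commute intro!: mult_left_mono)
    have "G w x' \<le> G (W k) x' + L * (2 * lam k)"
      using G_lip[OF that, of w "W k"] wd by linarith
    also have "G (W k) x' \<le> G (W k) (x k) + \<epsilon> k" using X(2)[OF that] by (simp add: x_def)
    also have "G (W k) (x k) \<le> G w (x k) + L * (2 * lam k)"
      using G_lip[OF xy(1), of "W k" k w] wd by linarith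
    finally have "G w x' \<le> G w (x k) + (\<epsilon> k + 4 * L * lam k)" by simp
    moreover have "(2 + 4 * L) / (real k + 2) \<ge> 0" using L by simp
    ultimately show ?thesis unfolding \<delta>_def by linarith
  qed
  show ?thesis
  proof (rule that)
    show "norm w \<le> 2 * c" using w_diff[of 0] by (simp add: W lam_def)
    have "(\<lambda>k. (2 + 4 * L) / (real k + 2)) \<longlonglongrightarrow> 0" by real_asymp
    moreover have "\<epsilon> \<longlonglongrightarrow> 0" unfolding lam_Suc[symmetric, abs_def]
      using \<open>lam \<longlonglongrightarrow> 0\<close> by (rule LIMSEQ_Suc)
    ultimately have "\<delta> \<longlonglongrightarrow> 0 + 4 * L * 0 + 0"
      unfolding \<delta>_def[abs_def] using \<open>lam \<longlonglongrightarrow> 0\<close> by (intro tendsto_intros)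
    then show "\<delta> \<longlonglongrightarrow> 0" by simp
    show "\<forall>k. \<forall>m>k. norm (T (x k)) - \<delta> k \<le> norm (T (x m) (y k))" using key by blast
    show "\<forall>k x'. norm x' \<le> 1 \<longrightarrow> G w x' \<le> G w (x k) + \<delta> k" using max by blast
  qed (use xy in auto)
qed

subsection \<open>Rank-one perturbations\<close>

lemma mem_ops_to_dual_iff:
  fixes sX :: "'k::real_or_complex \<Rightarrow> 'a::real_normed_vector \<Rightarrow> 'a"
    and sY :: "'k \<Rightarrow> 'b::real_normed_vector \<Rightarrow> 'b"
  assumes sX: "normed_space_over sX"
  shows "T \<in> ops_to_dual sX sY \<longleftrightarrow>
    (\<forall>c x. blinfun_apply T (sX c x) = dual_scale c (blinfun_apply T x)) \<and>
    (\<forall>x. blinfun_apply T x \<in> dual sY)"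
  using normed_space_over.axioms(1)[OF sX]
    normed_space_over.axioms(1)[OF normed_space_over_dual_scale]
  by (auto simp: ops_to_dual_def bounded_ops_def Vector_Spaces.linear_iff blinfun.add_right)

text \<open>The filter concentrated at the origin suffices. This settles the degenerate case in
  which one of the spaces is zero.\<close>

lemma zero_in_wstar_QNA:
  fixes sX :: "'k::real_or_complex \<Rightarrow> 'a::real_normed_vector \<Rightarrow> 'a"
    and sY :: "'k \<Rightarrow> 'b::real_normed_vector \<Rightarrow> 'b"
  assumes "0 \<in> ops_to_dual sX sY"
  shows "0 \<in> wstar_QNA sX sY"
proof -
  have 0: "0 \<in> dual sY" using assms by (auto simp: ops_to_dual_def)
  then have "limitin (weak_star sY) (blinfun_apply 0) 0 (principal {0::'a})"
    by (subst limitin_weak_star_iff) auto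
  then show ?thesis
    unfolding wstar_QNA_def using assms 0
    by (auto intro!: exI[of _ "principal {0}"] exI[of _ 0] simp: principal_eq_bot_iff
        eventually_principal)
qed

definition rank_one_op ::
  "('a::real_normed_vector \<Rightarrow>\<^sub>L 'k::real_or_complex) \<Rightarrow> ('b::real_normed_vector \<Rightarrow>\<^sub>L 'k) \<Rightarrow> ('a \<Rightarrow>\<^sub>L 'b \<Rightarrow>\<^sub>L 'k)"
  where "rank_one_op f g = Blinfun (\<lambda>x. dual_scale (blinfun_apply f x) g)"

lemma
  fixes f :: "'a::real_normed_vector \<Rightarrow>\<^sub>L 'k::real_or_complex"
    and g :: "'b::real_normed_vector \<Rightarrow>\<^sub>L 'k"
  shows rank_one_op_apply [simp]: "blinfun_apply (rank_one_op f g) x =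
      dual_scale (blinfun_apply f x) g"
    and norm_rank_one_op_le: "norm (rank_one_op f g) \<le> norm f * norm g"
proof -
  interpret D: normed_space_over "dual_scale :: 'k \<Rightarrow> ('b \<Rightarrow>\<^sub>L 'k) \<Rightarrow> _"
    by (rule normed_space_over_dual_scale)
  have le: "norm (dual_scale (f x) g) \<le> norm f * norm g * norm x" for x
    using mult_right_mono[OF norm_blinfun[of f x] norm_ge_zero[of g]]
    by (simp add: D.norm_scale ac_simps)
  have "bounded_linear (\<lambda>x. dual_scale (f x) g)"
  proof (rule bounded_linear_intro)
    show "dual_scale (f (r *\<^sub>R x)) g = r *\<^sub>R dual_scale (f x) g" for r x
      by (simp add: blinfun.scaleR_right scaleR_conv_of_real flip: D.scale_of_real D.scale_scale)
    show "norm (dual_scale (f x) g) \<le> norm x * (norm f * norm g)" for x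
      using le[of x] by (simp add: mult.commute)
  qed (simp add: blinfun.add_right D.scale_left_distrib)
  then show app: "rank_one_op f g x = dual_scale (f x) g" for x
    by (simp add: rank_one_op_def bounded_linear_Blinfun_apply)
  show "norm (rank_one_op f g) \<le> norm f * norm g"
    by (rule norm_blinfun_bound) (simp_all add: app le)
qed

text \<open>A nonzero functional is onto the scalars, so the range is exactly the line spanned by
  \<open>g\<close>.\<close>

lemma rank_one_rank_one_op:
  fixes f :: "'a::real_normed_vector \<Rightarrow>\<^sub>L 'k::real_or_complex"
    and g :: "'b::real_normed_vector \<Rightarrow>\<^sub>L 'k"
  assumes s: "normed_space_over s" and f: "f \<in> dual s" "f \<noteq> 0" and g: "g \<noteq> 0"
  shows "rank_one (rank_one_op f g)"
proof -
  interpret D: normed_space_over "dual_scale :: 'k \<Rightarrow> ('b \<Rightarrow>\<^sub>L 'k) \<Rightarrow> _"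
    by (rule normed_space_over_dual_scale)
  obtain x where x: "f x \<noteq> 0" using f(2) by (metis blinfun_eqI zero_blinfun.rep_eq)
  have "range (rank_one_op f g) = range (\<lambda>c. dual_scale c g)"
  proof
    show "range (\<lambda>c. dual_scale c g) \<subseteq> range (rank_one_op f g)"
    proof
      fix h assume "h \<in> range (\<lambda>c. dual_scale c g)"
      then obtain c where "h = dual_scale c g" by blast
      moreover have "f (s (c / f x) x) = c" using f(1) x by (simp add: mem_dual_iff[OF s])
      ultimately have "h = rank_one_op f g (s (c / f x) x)" by simp
      then show "h \<in> range (rank_one_op f g)" by blast
    qed
  qed auto
  also have "\<dots> = D.span {g}" by (rule D.span_singleton[symmetric])
  finally show ?thesis
    using g D.dim_span_eq_card_independent[of "{g}"]
    by (simp add: rank_one_def D.independent_insert)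
qed

text \<open>Take \<open>g\<close> as \<open>c\<close> times a unit functional \<open>v\<close> in
  the direction of \<open>u\<close> (any unit functional if \<open>u = 0\<close>), with
  \<open>c\<close> cancelling the phase of \<zeta>; then both summands are nonnegative multiples of
  \<open>v\<close>.\<close>

lemma exists_unit_add_aligned:
  fixes s :: "'k::real_or_complex \<Rightarrow> 'b::real_normed_vector \<Rightarrow> 'b"
  assumes s: "normed_space_over s" and nontriv: "b \<noteq> (0 :: 'b)" and u: "u \<in> dual s"
  obtains g where "g \<in> dual s" "norm g = 1" "norm (u + dual_scale \<zeta> g) = norm u + norm \<zeta>"
proof -
  interpret D: normed_space_over "dual_scale :: 'k \<Rightarrow> ('b \<Rightarrow>\<^sub>L 'k) \<Rightarrow> _"
    by (rule normed_space_over_dual_scale)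
  obtain v where v: "v \<in> dual s" "norm v = 1" "u = norm u *\<^sub>R v"
  proof (cases "u = 0")
    case True
    then show ?thesis using dual_norm_eq[OF s nontriv, of 1] that by auto
  next
    case False
    then show ?thesis
      using u that[of "u /\<^sub>R norm u"] by (simp add: mem_dual_iff[OF s] blinfun.bilinear_simps)
  qed
  obtain c where c: "norm c = 1" "c * \<zeta> = of_real (norm \<zeta>)" by (rule exists_unit_norm_mult)
  show ?thesis
  proof (rule that)
    show "dual_scale c v \<in> dual s" using v(1) by (simp add: mem_dual_iff[OF s] ac_simps)
    show "norm (dual_scale c v) = 1" by (simp add: D.norm_scale c v)
    have "dual_scale \<zeta> (dual_scale c v) = norm \<zeta> *\<^sub>R v"
      using c(2) by (simp add: mult.commute D.scale_of_real)
    then have "u + dual_scale \<zeta> (dual_scale c v) = (norm u + norm \<zeta>) *\<^sub>R v"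
      using v(3) by (metis scaleR_left_distrib)
    then show "norm (u + dual_scale \<zeta> (dual_scale c v)) = norm u + norm \<zeta>"
      using v(2) by simp
  qed
qed

lemma exists_rank_one_perturbation:
  fixes sX :: "'k::real_or_complex \<Rightarrow> 'a::real_normed_vector \<Rightarrow> 'a"
    and sY :: "'k \<Rightarrow> 'b::banach \<Rightarrow> 'b"
  assumes sX: "normed_space_over sX" and sY: "normed_space_over sY"
    and a: "a \<noteq> (0 :: 'a)" and b: "b \<noteq> (0 :: 'b)"
    and T: "T \<in> ops_to_dual sX sY" and \<epsilon>: "\<epsilon> > 0"
  obtains S where "S \<in> wstar_QNA sX sY" "norm (T - S) < \<epsilon>" "rank_one (T - S)"
proof -
  have TX: "T (sX c x) = dual_scale c (T x)" and TY: "T x \<in> dual sY" for c x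
    using T by (auto simp: mem_ops_to_dual_iff[OF sX])
  \<comment> \<open>With \<open>norm w \<le> 2 * c\<close> the functional \<open>Tw\<close> has norm
    below \<open>\<epsilon> / 2\<close>; adding 1 avoids division by zero when
    \<open>T = 0\<close>.\<close>
  define c where "c = \<epsilon> / (8 * (norm T + 1))"
  have c: "c > 0" using \<epsilon> by (simp add: c_def add_nonneg_pos)
  have "c * (norm T + 1) = \<epsilon> / 8"
  proof -
    have "norm T + 1 \<noteq> 0" using norm_ge_zero[of T] by linarith
    then show ?thesis unfolding c_def by (simp add: divide_simps)
  qed
  then have cT: "norm T * (2 * c) < \<epsilon> / 2"
    using \<epsilon> c by (simp add: algebra_simps)
  \<comment> \<open>The norm is exactly \<open>\<epsilon> / 2\<close>, strictly larger than that of
    \<open>Tw\<close>, so \<open>z0 + Tw\<close> has norm below \<epsilon> and yet cannot vanish; a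
    vanishing sum would make the perturbation zero instead of rank one.\<close>
  obtain z0 where z0: "z0 \<in> dual sX" "norm z0 = \<epsilon> / 2"
    using dual_norm_eq[OF sX a, of "\<epsilon> / 2"] \<epsilon> by auto
  obtain w x y \<delta> where w: "norm w \<le> 2 * c"
    and x: "\<forall>n. norm (x n) \<le> 1" and y: "\<forall>n. norm (y n) \<le> 1" and \<delta>: "\<delta> \<longlonglongrightarrow> 0"
    and near_norm: "\<forall>k. \<forall>m>k. norm (T (x k)) - \<delta> k \<le> norm (T (x m) (y k))"
    and near_max: "\<forall>k x'. norm x' \<le> 1 \<longrightarrow>
      norm (T x') + norm (z0 x' + T x' w) \<le> norm (T (x k)) + norm (z0 (x k) + T (x k) w) + \<delta> k"
    by (rule perturbed_optimization[OF sY TY c])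
  define Tw where "Tw = Blinfun (\<lambda>x. T x w)"
  have Tw: "Tw x = T x w" for x
    by (simp add: Tw_def bounded_linear_Blinfun_apply bounded_linear_intros
        bounded_linear_compose[OF blinfun.bounded_linear_left blinfun.bounded_linear_right])
  define z where "z = z0 + Tw"
  have z: "z x = z0 x + T x w" for x by (simp add: z_def Tw blinfun.add_left)
  have z_dual: "z \<in> dual sX"
    using z0(1) by (simp add: mem_dual_iff[OF sX] z TX distrib_left)
  have "norm Tw \<le> norm T * (2 * c)"
  proof (rule norm_blinfun_bound)
    fix x'
    have "norm (T x' w) \<le> norm (T x') * norm w" by (rule norm_blinfun)
    also have "\<dots> \<le> (norm T * norm x') * (2 * c)"
      using w c norm_blinfun[of T x'] by (intro mult_mono) auto
    finally show "norm (Tw x') \<le> norm T * (2 * c) * norm x'" by (simp add: Tw ac_simps)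
  qed (use c in simp)
  then have Tw_less: "norm Tw < \<epsilon> / 2" using cT by linarith
  have z_less: "norm z < \<epsilon>"
    using norm_triangle_ineq[of z0 Tw] Tw_less z0(2) by (simp add: z_def)
  have "z \<noteq> 0"
  proof
    assume "z = 0"
    then have "z0 = - Tw" by (simp add: z_def add_eq_0_iff2)
    then show False using Tw_less z0(2) by simp
  qed
  define p where "p n = norm (T (x n)) + norm (z (x n))" for n
  have max: "norm (T x') + norm (z x') \<le> p k + \<delta> k" if "norm x' \<le> 1" for x' k
    using near_max that by (simp add: p_def z)
  have "norm (T (x n)) \<le> norm T" for n
    using norm_blinfun[of T "x n"] mult_left_mono[OF x[rule_format, of n] norm_ge_zero[of T]]
    by simp
  moreover have "norm (z (x n)) \<le> norm z" for n
    using norm_blinfun[of z "x n"] mult_left_mono[OF x[rule_format, of n] norm_ge_zero[of z]]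
    by simp
  ultimately obtain F u \<zeta> where F: "F \<noteq> bot" "F \<le> sequentially" and u: "u \<in> dual sY"
    and lim_u: "\<forall>v. ((\<lambda>n. T (x n) v) \<longlongrightarrow> u v) F" and lim_\<zeta>: "((\<lambda>n. z (x n)) \<longlongrightarrow> \<zeta>) F"
    by (rule weak_star_cluster[OF sY TY])
  \<comment> \<open>Weak-star limits may lose norm; here the fixed vector \<open>y k\<close> tests
    all \<open>T (x m)\<close> with \<open>m > k\<close>, so its lower bound survives the limit in
    \<open>m\<close>.\<close>
  have norm_u: "norm (T (x k)) - \<delta> k \<le> norm u" for k
  proof -
    have "\<forall>\<^sub>F m in F. norm (T (x k)) - \<delta> k \<le> norm (T (x m) (y k))"
      using filter_leD[OF F(2) eventually_gt_at_top[of k]]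
      by eventually_elim (use near_norm in blast)
    then have "norm (T (x k)) - \<delta> k \<le> norm (u (y k))"
      by (rule tendsto_lowerbound[OF tendsto_norm[OF lim_u[rule_format]] _ F(1)])
    also have "\<dots> \<le> norm u"
      using norm_blinfun[of u "y k"] mult_left_mono[OF y[rule_format, of k] norm_ge_zero[of u]]
      by simp
    finally show ?thesis .
  qed
  \<comment> \<open>One \<open>\<delta> k\<close> comes from near-maximality and one from
    \<open>norm_u\<close>; both vanish as \<open>k\<close> runs along \<open>F\<close>.\<close>
  have sup: "norm (T x') + norm (z x') \<le> norm u + norm \<zeta>" if "norm x' \<le> 1" for x'
  proof -
    have "((\<lambda>k. norm u + norm (z (x k)) + 2 * \<delta> k) \<longlongrightarrow> norm u + norm \<zeta> + 2 * 0) F"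
      by (intro tendsto_intros lim_\<zeta> tendsto_mono[OF F(2) \<delta>])
    moreover have "norm (T x') + norm (z x') \<le> norm u + norm (z (x k)) + 2 * \<delta> k" for k
      using max[OF that, of k] norm_u[of k] by (simp add: p_def)
    ultimately show ?thesis
      using tendsto_lowerbound[OF _ _ F(1)] by (metis (no_types, lifting)
          add.right_neutral always_eventually mult_zero_right)
  qed
  obtain g where g: "g \<in> dual sY" "norm g = 1" "norm (u + dual_scale \<zeta> g) = norm u + norm \<zeta>"
    by (rule exists_unit_add_aligned[OF sY b u])
  define v where "v = u + dual_scale \<zeta> g"
  define S where "S = T + rank_one_op z g"
  have S_apply: "S x' = T x' + dual_scale (z x') g" for x' by (simp add: S_def blinfun.add_left)
  interpret D: normed_space_over "dual_scale :: 'k \<Rightarrow> ('b \<Rightarrow>\<^sub>L 'k) \<Rightarrow> _"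
    by (rule normed_space_over_dual_scale)
  have S_ops: "S \<in> ops_to_dual sX sY"
    using z_dual TY g(1)
    by (simp add: mem_ops_to_dual_iff[OF sX] S_apply TX D.scale_right_distrib
        mem_dual_iff[OF sX] mem_dual_iff[OF sY] blinfun.add_left algebra_simps)
  have S_lim: "((\<lambda>n. S (x n) h) \<longlongrightarrow> v h) F" for h
    unfolding S_apply v_def blinfun.add_left dual_scale_apply
    by (intro tendsto_intros lim_u[rule_format] lim_\<zeta>)
  have v: "v \<in> dual sY"
    using u g(1) by (simp add: v_def mem_dual_iff[OF sY] blinfun.add_left algebra_simps)
  have norm_S_apply: "norm (S x') \<le> norm v" if "norm x' \<le> 1" for x'
    using sup[OF that] norm_triangle_ineq[of "T x'" "dual_scale (z x') g"]
    by (simp add: S_apply v_def g D.norm_scale)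
  \<comment> \<open>The bound \<open>sup\<close> limits \<open>S\<close> on the unit ball by
    \<open>norm u + norm \<zeta>\<close>, which the alignment of \<open>g\<close> makes equal to
    \<open>norm v\<close>. The converse is weak-star lower semicontinuity of the norm.\<close>
  have "norm v = norm S"
  proof (rule antisym)
    show "norm S \<le> norm v"
    proof (rule norm_blinfun_bound)
      fix x' show "norm (S x') \<le> norm v * norm x'"
      proof (cases "x' = 0")
        case False
        then have "norm (S (x' /\<^sub>R norm x')) \<le> norm v" by (intro norm_S_apply) simp
        then show ?thesis using False by (simp add: blinfun.scaleR_right field_simps)
      qed simp
    qed simp
    show "norm v \<le> norm S"
    proof (rule norm_blinfun_bound)
      fix h
      have "norm (S (x n) h) \<le> norm S * norm h" for n
      proof -
        have "norm (S (x n)) \<le> norm S"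
          using norm_blinfun[of S "x n"] mult_left_mono[OF x[rule_format, of n] norm_ge_zero[of S]]
          by simp
        then show ?thesis
          using norm_blinfun[of "S (x n)" h] by (meson mult_right_mono norm_ge_zero order_trans)
      qed
      then show "norm (v h) \<le> norm S * norm h"
        by (intro tendsto_upperbound[OF tendsto_norm[OF S_lim] _ F(1)]) simp
    qed simp
  qed
  moreover have "limitin (weak_star sY) (blinfun_apply S) v (filtermap x F)"
  proof (subst limitin_weak_star_iff)
    show "\<forall>\<^sub>F x' in filtermap x F. S x' \<in> dual sY"
      using S_ops by (simp add: mem_ops_to_dual_iff[OF sX])
    show "v \<in> dual sY \<and> (\<forall>h. ((\<lambda>x'. S x' h) \<longlongrightarrow> v h) (filtermap x F))"
      using v S_lim by (simp add: tendsto_compose_filtermap[symmetric] o_def filterlim_filtermap)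
  qed
  moreover have "filtermap x F \<noteq> bot" using F(1) by (simp add: filtermap_bot_iff)
  moreover have "\<forall>\<^sub>F x' in filtermap x F. x' \<in> cball 0 1" using x by (simp add: eventually_filtermap)
  ultimately have "S \<in> wstar_QNA sX sY"
    unfolding wstar_QNA_def using S_ops v by blast
  moreover have diff: "T - S = rank_one_op (- z) g"
    by (rule blinfun_eqI, rule blinfun_eqI)
      (simp add: S_apply blinfun.bilinear_simps)
  moreover have "norm (T - S) < \<epsilon>"
    using norm_rank_one_op_le[of "- z" g] z_less g(2) by (simp add: diff)
  moreover have "rank_one (T - S)"
    unfolding diff
  proof (rule rank_one_rank_one_op[OF sX])
    show "- z \<in> dual sX" using z_dual by (simp add: mem_dual_iff[OF sX] blinfun.minus_left)
    show "- z \<noteq> 0" using \<open>z \<noteq> 0\<close> by simp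
    show "g \<noteq> 0" using g(2) by auto
  qed
  ultimately show ?thesis using that by blast
qed

theorem theorem2p1:
  fixes sX :: "'k::real_or_complex \<Rightarrow> 'a::banach \<Rightarrow> 'a"
    and sY :: "'k \<Rightarrow> 'b::banach \<Rightarrow> 'b"
  assumes "normed_space_over sX" and "normed_space_over sY"
  shows "ops_to_dual sX sY \<subseteq> closure (wstar_QNA sX sY) \<and>
    (\<forall>T \<in> ops_to_dual sX sY. \<forall>\<epsilon>>0. \<exists>S \<in> wstar_QNA sX sY.
       norm (T - S) < \<epsilon> \<and>
       (if (UNIV :: 'a set) = {0} \<or> (UNIV :: 'b set) = {0} then S = T else rank_one (T - S)))"
proof -
  have approx: "\<exists>S \<in> wstar_QNA sX sY. norm (T - S) < \<epsilon> \<and>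
      (if (UNIV :: 'a set) = {0} \<or> (UNIV :: 'b set) = {0} then S = T else rank_one (T - S))"
    if T: "T \<in> ops_to_dual sX sY" and \<epsilon>: "\<epsilon> > 0" for T \<epsilon>
  proof (cases "(UNIV :: 'a set) = {0} \<or> (UNIV :: 'b set) = {0}")
    \<comment> \<open>No rank-one operator exists here, and the only operator is 0, which attains
      its norm without perturbation.\<close>
    case True
    have "T = 0"
    proof (rule blinfun_eqI, rule blinfun_eqI)
      fix x :: 'a and y :: 'b
      have "x = 0" if "(UNIV :: 'a set) = {0}"
        by (rule that[THEN equalityD1, THEN subsetD, THEN singletonD]) (rule UNIV_I)
      moreover have "y = 0" if "(UNIV :: 'b set) = {0}"
        by (rule that[THEN equalityD1, THEN subsetD, THEN singletonD]) (rule UNIV_I)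
      ultimately have "x = 0 \<or> y = 0" using True by argo
      then show "T x y = blinfun_apply (blinfun_apply 0 x) y" by auto
    qed
    then have "T \<in> wstar_QNA sX sY" using zero_in_wstar_QNA T by blast
    then show ?thesis using True \<epsilon> by (intro bexI[of _ T]) auto
  next
    case False
    have "(\<exists>a :: 'a. a \<noteq> 0)" "(\<exists>b :: 'b. b \<noteq> 0)" using False by auto
    then obtain a :: 'a and b :: 'b where "a \<noteq> 0" "b \<noteq> 0" by blast
    then obtain S where "S \<in> wstar_QNA sX sY" "norm (T - S) < \<epsilon>" "rank_one (T - S)"
      by (rule exists_rank_one_perturbation[OF assms _ _ T \<epsilon>])
    then show ?thesis using False by auto
  qed
  moreover have "ops_to_dual sX sY \<subseteq> closure (wstar_QNA sX sY)"
  proof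
    fix T assume T: "T \<in> ops_to_dual sX sY"
    show "T \<in> closure (wstar_QNA sX sY)"
      unfolding closure_approachable
    proof (intro allI impI)
      fix e :: real assume "e > 0"
      from approx[OF T this] show "\<exists>S\<in>wstar_QNA sX sY. dist S T < e"
        by (auto simp: dist_norm norm_minus_commute)
    qed
  qed
  ultimately show ?thesis by blast
qed

end
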